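(* Let $A\in\mathbb{R}^{n\times n}$ be symmetric positive semidefinite, let $p\ge1$, $M\ge1$, and let $X_M=\left(\frac1M\sum_{j=1}^M w_j^TA^pw_j\right)^{1/p}$ with $w_1,\dots,w_M$ independent standard Gaussian random vectors in $\mathbb{R}^n$. Then the bias of $X_M$ is bounded as $$\big|\mathbb{E}(X_M)-\|A\|_{S_p}\big|\ \le\ \|A\|_{S_p}\left(\frac{2}{M}\right)^{1/2}.$$
   Context: For a symmetric positive semidefinite matrix $A\in\mathbb{R}^{n\times n}$ with eigenvalues $\lambda_1,\dots,\lambda_n\ge 0$ and $p\ge1$, the Schatten $p$-norm is $\|A\|_{S_p}=\big(\sum_{j=1}^n\lambda_j^p\big)^{1/p}=(\operatorname{tr}(A^p))^{1/p}$, where $A^p$ is defined through the spectral decomposition. The samples $w_j:\Omega\to\mathbb{R}^n$ are independent random vectors on a probability space $(\Omega,\mathcal{F},\mathbb{P})$ whose entries are independent standard normal random variables. *)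

theory Defs
  imports "HOL-Analysis.Analysis" "HOL-Probability.Probability"
    "HOL-Computational_Algebra.Computational_Algebra"
begin

definition positive_semidefinite :: "real ^ 'n ^ 'n \<Rightarrow> bool" where
  "positive_semidefinite A \<longleftrightarrow> transpose A = A \<and> (\<forall>x. 0 \<le> x \<bullet> (A *v x))"

definition diagonal_matrix :: "real ^ 'n \<Rightarrow> real ^ 'n ^ 'n" where
  "diagonal_matrix d = (\<chi> i j. if i = j then d $ i else 0)"

definition char_polynomial :: "real ^ 'n ^ 'n \<Rightarrow> real poly" where
  "char_polynomial A = det (\<chi> i j. (if i = j then [:0, 1:] else 0) - [:A $ i $ j:])"

text \<open>The real eigenvalues, repeated according to algebraic multiplicity.\<close>

definition eigenvalues :: "real ^ 'n ^ 'n \<Rightarrow> real multiset" where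
  "eigenvalues A = proots (char_polynomial A)"

definition schatten_norm :: "real \<Rightarrow> real ^ 'n ^ 'n \<Rightarrow> real" where
  "schatten_norm p A = (\<Sum>l\<in>#eigenvalues A. l powr p) powr (1 / p)"

text \<open>
  The power \<open>A\<^sup>p\<close> of a positive semidefinite matrix for a real exponent, through a spectral
  decomposition \<open>A = Q D Q\<^sup>T\<close>. The result does not depend on the decomposition, by
  \<open>matrix_powr_eq\<close> below. Note that \<open>0 powr p = 0\<close>, which is the intended value
  for \<open>p > 0\<close>.
\<close>

definition matrix_powr :: "real ^ 'n ^ 'n \<Rightarrow> real \<Rightarrow> real ^ 'n ^ 'n" where
  "matrix_powr A p = (THE B. \<exists>Q d. orthogonal_matrix Q \<and>
     A = Q ** diagonal_matrix d ** transpose Q \<and>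
     B = Q ** diagonal_matrix (\<chi> i. d $ i powr p) ** transpose Q)"

lemma matrix_mult_diagonal_nth: "(U ** diagonal_matrix d) $ i $ j = U $ i $ j * d $ j"
  by (simp add: matrix_matrix_mult_def diagonal_matrix_def if_distrib[of "(*) _"] cong: if_cong)

lemma diagonal_matrix_mult_nth: "(diagonal_matrix d ** U) $ i $ j = d $ i * U $ i $ j"
  by (simp add: matrix_matrix_mult_def diagonal_matrix_def if_distrib[of "\<lambda>x. x * _"] cong: if_cong)

lemma spectral_powr_unique:
  fixes Q R :: "real ^ 'n ^ 'n"
  assumes Q: "orthogonal_matrix Q" and R: "orthogonal_matrix R"
    and eq: "Q ** diagonal_matrix d ** transpose Q = R ** diagonal_matrix e ** transpose R"
  shows "Q ** diagonal_matrix (\<chi> i. d $ i powr p) ** transpose Q =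
         R ** diagonal_matrix (\<chi> i. e $ i powr p) ** transpose R"
proof -
  define U where "U = transpose R ** Q"
  have QQ: "transpose Q ** Q = mat 1" "Q ** transpose Q = mat 1"
    and RR: "transpose R ** R = mat 1" "R ** transpose R = mat 1"
    using Q R by (auto simp: orthogonal_matrix_def)
  have conj_iff: "Q ** X ** transpose Q = R ** Y ** transpose R \<longleftrightarrow> U ** X = Y ** U" for X Y
  proof
    assume h: "Q ** X ** transpose Q = R ** Y ** transpose R"
    have "U ** X = transpose R ** (Q ** X ** transpose Q) ** Q"
      by (simp add: U_def matrix_mul_assoc[symmetric] QQ)
    also have "\<dots> = (transpose R ** R) ** Y ** (transpose R ** Q)"
      unfolding h by (simp only: matrix_mul_assoc)
    finally show "U ** X = Y ** U"
      by (simp add: RR U_def)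
  next
    assume h: "U ** X = Y ** U"
    have "Q ** X ** transpose Q = (R ** transpose R) ** Q ** X ** transpose Q"
      by (simp add: RR)
    also have "\<dots> = R ** (U ** X) ** transpose Q"
      by (simp only: U_def matrix_mul_assoc)
    also have "\<dots> = R ** Y ** transpose R ** (Q ** transpose Q)"
      unfolding h by (simp only: U_def matrix_mul_assoc)
    finally show "Q ** X ** transpose Q = R ** Y ** transpose R"
      by (simp add: QQ)
  qed
  have "U ** diagonal_matrix d = diagonal_matrix e ** U"
    using eq conj_iff by blast
  then have "U $ i $ j * d $ j = e $ i * U $ i $ j" for i j
    by (metis matrix_mult_diagonal_nth diagonal_matrix_mult_nth)
  then have "U $ i $ j = 0 \<or> d $ j = e $ i" for i j
    by (metis mult.commute mult_cancel_left)
  then have "U $ i $ j * d $ j powr p = e $ i powr p * U $ i $ j" for i j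
    by (metis mult.commute mult_zero_left)
  then have "U ** diagonal_matrix (\<chi> i. d $ i powr p) = diagonal_matrix (\<chi> i. e $ i powr p) ** U"
    by (simp add: vec_eq_iff matrix_mult_diagonal_nth diagonal_matrix_mult_nth)
  then show ?thesis
    using conj_iff by blast
qed

lemma matrix_powr_eq:
  assumes "orthogonal_matrix Q" and "A = Q ** diagonal_matrix d ** transpose Q"
  shows "matrix_powr A p = Q ** diagonal_matrix (\<chi> i. d $ i powr p) ** transpose Q"
  unfolding matrix_powr_def
proof (rule the_equality)
  show "\<exists>R e. orthogonal_matrix R \<and> A = R ** diagonal_matrix e ** transpose R \<and>
      Q ** diagonal_matrix (\<chi> i. d $ i powr p) ** transpose Q =
      R ** diagonal_matrix (\<chi> i. e $ i powr p) ** transpose R"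
    using assms by blast
next
  fix B
  assume "\<exists>R e. orthogonal_matrix R \<and> A = R ** diagonal_matrix e ** transpose R \<and>
      B = R ** diagonal_matrix (\<chi> i. e $ i powr p) ** transpose R"
  then show "B = Q ** diagonal_matrix (\<chi> i. d $ i powr p) ** transpose Q"
    using assms spectral_powr_unique by metis
qed

definition (in prob_space) standard_gaussian_vector :: "('a \<Rightarrow> real ^ 'n) \<Rightarrow> bool" where
  "standard_gaussian_vector w \<longleftrightarrow>
     indep_vars (\<lambda>_. borel) (\<lambda>i \<omega>. w \<omega> $ i) UNIV \<and>
     (\<forall>i. distributed M lborel (\<lambda>\<omega>. w \<omega> $ i) std_normal_density)"

definition schatten_estimator ::
  "real \<Rightarrow> real ^ 'n ^ 'n \<Rightarrow> (nat \<Rightarrow> 'a \<Rightarrow> real ^ 'n) \<Rightarrow> nat \<Rightarrow> 'a \<Rightarrow> real" where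
  "schatten_estimator p A w M \<omega> =
     ((1 / real M) * (\<Sum>j = 1..M. w j \<omega> \<bullet> (matrix_powr A p *v w j \<omega>))) powr (1 / p)"

end

theory Submission
  imports Defs
begin

text \<open>
  Write \<open>B = A\<^sup>p\<close>, which is positive semidefinite. Isserlis' theorem shows that the quadratic form
  \<open>w\<^sup>T B w\<close> of a standard Gaussian vector has mean \<open>tr B\<close> and variance \<open>2 tr (B\<^sup>2) \<le> 2 (tr B)\<^sup>2\<close>, so the
  average of \<open>M\<close> independent copies lies, in mean, within \<open>tr B \<cdot> sqrt (2 / M)\<close> of \<open>tr B\<close>. As
  \<open>\<bar>t\<^sup>1\<^sup>/\<^sup>p - 1\<bar> \<le> \<bar>t - 1\<bar>\<close> for \<open>t \<ge> 0\<close>, the relative error does not increase on taking the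
  \<open>p\<close>-th root, and the \<open>p\<close>-th root of \<open>tr B\<close> is the Schatten norm.
\<close>

no_notation fps_nth (infixl "$" 75)

section \<open>Spectral theorem for real symmetric matrices\<close>

text \<open>For small \<open>t\<close> of sign opposite to \<open>b\<close> the linear term would
  dominate and make the expression negative. This serves as the first-order condition at a maximum
  of the Rayleigh quotient.\<close>

lemma quadratic_nonneg_imp_linear_coeff_zero:
  fixes a b :: real
  assumes "\<And>t. 0 \<le> 2 * t * b + t\<^sup>2 * a"
  shows "b = 0"
proof (rule ccontr)
  assume b: "b \<noteq> 0"
  have a: "a \<ge> 0" using assms[of 1] assms[of "-1"] by simp
  \<comment> \<open>For \<open>a > 0\<close> the minimiser is \<open>- b / a\<close>; the
    denominator \<open>a + 1\<close> also covers \<open>a = 0\<close>.\<close>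
  have "0 \<le> 2 * (- b / (a + 1)) * b + (- b / (a + 1))\<^sup>2 * a" by (rule assms)
  also have "\<dots> = - (b\<^sup>2 * (a + 2)) / (a + 1)\<^sup>2"
    using a by (simp add: divide_simps power2_eq_square) algebra
  also have "\<dots> < 0" using a b by (simp add: divide_simps)
  finally show False by simp
qed

lemma symmetric_matrix_inner:
  fixes A :: "real ^ 'n ^ 'n"
  assumes "transpose A = A"
  shows "x \<bullet> (A *v y) = (A *v x) \<bullet> y"
  by (metis assms dot_lmul_matrix transpose_matrix_vector)

text \<open>The eigenvector is a maximiser \<open>v\<close> of the quadratic form on the unit sphere
  of \<open>S\<close>, which is compact and nonempty. Invariance puts the residual \<open>u\<close>
  of the eigenvalue equation into \<open>S\<close>, so \<open>u\<close> is an admissible direction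
  of variation.\<close>

lemma symmetric_eigenvector_in_subspace:
  fixes A :: "real ^ 'n ^ 'n"
  assumes sym: "transpose A = A" and S: "subspace S" "S \<noteq> {0}"
    and inv: "\<And>x. x \<in> S \<Longrightarrow> A *v x \<in> S"
  obtains v c where "v \<in> S" "norm v = 1" "A *v v = c *\<^sub>R v"
proof -
  define g where "g = (\<lambda>x. x \<bullet> (A *v x))"
  have "compact (S \<inter> sphere 0 1)"
    using S by (intro closed_Int_compact closed_subspace) auto
  moreover have "S \<inter> sphere 0 1 \<noteq> {}"
  proof -
    obtain x where "x \<in> S" "x \<noteq> 0" using S subspace_0 by blast
    then have "x /\<^sub>R norm x \<in> S \<inter> sphere 0 1" using S by (simp add: subspace_scale)
    then show ?thesis by blast
  qed
  moreover have "continuous_on (S \<inter> sphere 0 1) g"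
    unfolding g_def by (intro continuous_intros matrix_vector_mult_linear_continuous_on)
  ultimately obtain v where v: "v \<in> S" "norm v = 1"
    and max: "\<And>x. x \<in> S \<Longrightarrow> norm x = 1 \<Longrightarrow> g x \<le> g v"
    using continuous_attains_sup by (metis (no_types, lifting) IntD1 IntD2 IntI dist_0_norm mem_sphere)
  have scale: "g x \<le> g v * (x \<bullet> x)" if x: "x \<in> S" for x
  proof (cases "x = 0")
    case False
    have "g (x /\<^sub>R norm x) \<le> g v"
      using False x S by (intro max) (auto simp: subspace_scale)
    moreover have "g (x /\<^sub>R norm x) = g x / (x \<bullet> x)"
      by (simp add: g_def matrix_vector_mult_scaleR power2_norm_eq_inner[symmetric] power2_eq_square divide_simps)
    ultimately have "g x / (x \<bullet> x) \<le> g v" by simp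
    then show ?thesis using False by (simp add: pos_divide_le_eq)
  qed (simp add: g_def)
  define u where "u = g v *\<^sub>R v - A *v v"
  have u: "u \<in> S" unfolding u_def using v S inv by (simp add: subspace_diff subspace_scale)
  have vv: "v \<bullet> v = 1" using v by (simp add: norm_eq_1)
  \<comment> \<open>This is \<open>scale\<close> at \<open>v + t *\<^sub>R u\<close>, expanded in
    \<open>t\<close>: the constant terms cancel, and the definition of \<open>u\<close> turns the
    linear term into \<open>2 * t * (u \<bullet> u)\<close>.\<close>
  have "0 \<le> 2 * t * (u \<bullet> u) + t\<^sup>2 * (g v * (u \<bullet> u) - g u)" for t
  proof -
    have "g (v + t *\<^sub>R u) \<le> g v * ((v + t *\<^sub>R u) \<bullet> (v + t *\<^sub>R u))"
      using u v S by (intro scale) (simp add: subspace_add subspace_scale)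
    moreover have "g (v + t *\<^sub>R u) = g v + 2 * t * (u \<bullet> (A *v v)) + t\<^sup>2 * g u"
      using symmetric_matrix_inner[OF sym, of v u]
      by (simp add: g_def matrix_vector_right_distrib matrix_vector_mult_scaleR inner_add_left
          inner_add_right power2_eq_square inner_commute algebra_simps)
    moreover have "(v + t *\<^sub>R u) \<bullet> (v + t *\<^sub>R u) = 1 + 2 * t * (u \<bullet> v) + t\<^sup>2 * (u \<bullet> u)"
      using vv by (simp add: inner_add_left inner_add_right power2_eq_square inner_commute algebra_simps)
    moreover have "u \<bullet> u = g v * (u \<bullet> v) - u \<bullet> (A *v v)"
      by (subst (2) u_def) (simp add: inner_diff_right)
    ultimately have le: "g v + 2 * t * (u \<bullet> (A *v v)) + t\<^sup>2 * g u
        \<le> g v * (1 + 2 * t * (u \<bullet> v) + t\<^sup>2 * (u \<bullet> u))"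
      and "u \<bullet> u = g v * (u \<bullet> v) - u \<bullet> (A *v v)"
      by simp_all
    then have "2 * t * (u \<bullet> u) = 2 * t * (g v * (u \<bullet> v)) - 2 * t * (u \<bullet> (A *v v))"
      by (simp add: right_diff_distrib)
    with le show ?thesis by (simp add: algebra_simps)
  qed
  then have "u \<bullet> u = 0" by (rule quadratic_nonneg_imp_linear_coeff_zero)
  then have "A *v v = g v *\<^sub>R v" by (simp add: u_def)
  with v that show ?thesis by blast
qed

text \<open>Induction on the dimension: split off a unit eigenvector \<open>v\<close>. By symmetry
  its orthogonal complement \<open>T\<close> in \<open>S\<close> is again invariant, and its
  dimension is smaller.\<close>

lemma symmetric_orthonormal_eigenbasis:
  fixes A :: "real ^ 'n ^ 'n"
  assumes sym: "transpose A = A" and "subspace S" and "\<And>x. x \<in> S \<Longrightarrow> A *v x \<in> S"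
  shows "\<exists>B. pairwise orthogonal B \<and> (\<forall>b\<in>B. norm b = 1 \<and> (\<exists>c. A *v b = c *\<^sub>R b)) \<and> span B = S"
  using assms(2,3)
proof (induction "dim S" arbitrary: S rule: less_induct)
  case less
  show ?case
  proof (cases "S = {0}")
    case True
    then show ?thesis by (intro exI[of _ "{}"]) auto
  next
    case False
    obtain v c where v: "v \<in> S" "norm v = 1" "A *v v = c *\<^sub>R v"
      using symmetric_eigenvector_in_subspace[OF sym less.prems(1) False less.prems(2)] by metis
    have vv: "v \<bullet> v = 1" using v by (simp add: norm_eq_1)
    define T where "T = {x \<in> S. v \<bullet> x = 0}"
    have T: "subspace T"
      using less.prems(1) unfolding T_def subspace_def by (auto simp: inner_add_right)
    have "T \<subset> S" using v vv T_def by force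
    then have "dim T < dim S"
      using T less.prems(1) by (metis dim_psubset span_eq_iff)
    moreover have "A *v x \<in> T" if "x \<in> T" for x
      using that v less.prems(2) symmetric_matrix_inner[OF sym, of v x] by (simp add: T_def)
    ultimately obtain B where B: "pairwise orthogonal B" "span B = T"
      "\<forall>b\<in>B. norm b = 1 \<and> (\<exists>c. A *v b = c *\<^sub>R b)"
      using less.hyps T by metis
    have BT: "B \<subseteq> T" using B span_superset by blast
    have "pairwise orthogonal (insert v B)"
      using B BT unfolding pairwise_insert by (auto simp: T_def orthogonal_def inner_commute)
    moreover have "span (insert v B) = S"
    proof
      show "span (insert v B) \<subseteq> S"
        using BT v less.prems(1) by (intro span_minimal) (auto simp: T_def)
      show "S \<subseteq> span (insert v B)"
      proof
        fix x assume "x \<in> S"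
        then have "x - (v \<bullet> x) *\<^sub>R v \<in> T"
          using v vv less.prems(1) by (simp add: T_def subspace_diff subspace_scale inner_diff_right)
        then show "x \<in> span (insert v B)" using B by (auto simp: span_breakdown_eq)
      qed
    qed
    ultimately show ?thesis using B v by (intro exI[of _ "insert v B"]) auto
  qed
qed

text \<open>An orthonormal eigenbasis of the whole space supplies the columns of \<open>Q\<close>;
  the eigenvalue equations, read column by column, say that \<open>A ** Q\<close> is
  \<open>Q\<close> times a diagonal matrix.\<close>

lemma symmetric_spectral_decomposition:
  fixes A :: "real ^ 'n ^ 'n"
  assumes sym: "transpose A = A"
  obtains Q d where "orthogonal_matrix Q" "A = Q ** diagonal_matrix d ** transpose Q"
proof -
  obtain B where B: "pairwise orthogonal B" "span B = UNIV"
      "\<forall>b\<in>B. norm b = 1 \<and> (\<exists>c. A *v b = c *\<^sub>R b)"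
    using symmetric_orthonormal_eigenbasis[OF sym, of UNIV] by auto
  have "0 \<notin> B" using B by force
  then have indep: "independent B" using B pairwise_orthogonal_independent by blast
  then have "finite B" using independent_imp_finite by blast
  \<comment> \<open>The index type \<open>'n\<close> can enumerate the basis, so that
    \<open>Q\<close> is square.\<close>
  moreover have "card B = CARD('n)"
    using B indep by (metis dim_UNIV dim_span_eq_card_independent DIM_cart DIM_real mult.right_neutral)
  ultimately obtain b where b: "bij_betw b (UNIV :: 'n set) B"
    by (metis finite_same_card_bij finite)
  have bB: "b j \<in> B" for j using b by (auto simp: bij_betw_def)
  then have "\<forall>j. \<exists>c. A *v b j = c *\<^sub>R b j" using B(3) by blast
  then obtain d where d: "\<And>j. A *v b j = d j *\<^sub>R b j" by metis
  define Q :: "real ^ 'n ^ 'n" where "Q = (\<chi> i j. b j $ i)"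
  have col: "column j Q = b j" for j by (simp add: column_def Q_def)
  have Q: "orthogonal_matrix Q"
    unfolding orthogonal_matrix_orthonormal_columns col
    using B bB b by (auto simp: pairwise_def bij_betw_def inj_on_def) blast
  have "A ** Q = Q ** diagonal_matrix (\<chi> j. d j)"
  proof -
    have "(A ** Q) $ i $ j = (A *v b j) $ i" for i j
      by (simp add: matrix_matrix_mult_def matrix_vector_mult_def Q_def)
    then show ?thesis by (simp add: vec_eq_iff matrix_mult_diagonal_nth d) (simp add: Q_def)
  qed
  then have "A = Q ** diagonal_matrix (\<chi> j. d j) ** transpose Q"
    using Q by (metis matrix_mul_assoc matrix_mul_rid orthogonal_matrix_def)
  with Q that show ?thesis by blast
qed

section \<open>Eigenvalues, traces and real powers of matrices\<close>

lemma poly_det: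
  "poly (det M) x = det (\<chi> i j. poly (M $ i $ j) x)"
  by (simp add: det_def poly_sum poly_prod)

text \<open>Links the roots of the characteristic polynomial to a spectral decomposition.
  Conjugation by \<open>Q\<close> preserves the determinant, so at every real \<open>x\<close> the
  polynomial takes the value of a product of linear factors; agreement at all reals is equality of
  polynomials.\<close>

lemma eigenvalues_spectral:
  fixes Q :: "real ^ 'n ^ 'n"
  assumes Q: "orthogonal_matrix Q" and A: "A = Q ** diagonal_matrix d ** transpose Q"
  shows "eigenvalues A = image_mset (\<lambda>i. d $ i) (mset_set UNIV)"
proof -
  have QQ: "Q ** transpose Q = mat 1" using Q by (simp add: orthogonal_matrix_def)
  have "poly (char_polynomial A) x = poly (\<Prod>i\<in>UNIV. [:- d $ i, 1:]) x" for x
  proof -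
    have "poly (char_polynomial A) x = det (\<chi> i j. (if i = j then x else 0) - A $ i $ j)"
      unfolding char_polynomial_def poly_det
      by (intro arg_cong[where f = det]) (simp add: vec_eq_iff)
    also have "(\<chi> i j. (if i = j then x else 0) - A $ i $ j) = x *\<^sub>R mat 1 - A"
      by (simp add: vec_eq_iff mat_def)
    also have "\<dots> = Q ** diagonal_matrix (\<chi> i. x - d $ i) ** transpose Q"
    proof -
      have "diagonal_matrix (\<chi> i. x - d $ i) = x *\<^sub>R mat 1 - diagonal_matrix d"
        by (simp add: vec_eq_iff diagonal_matrix_def mat_def)
      moreover have "Q ** (X - Y) ** R = Q ** X ** R - Q ** Y ** R" for X Y R :: "real ^ 'n ^ 'n"
        by (simp add: vec_eq_iff matrix_matrix_mult_def algebra_simps sum_subtractf)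
      moreover have "Q ** (x *\<^sub>R mat 1) ** transpose Q = x *\<^sub>R mat 1"
        by (simp add: matrix_scalar_ac scalar_matrix_assoc[symmetric] QQ)
      ultimately show ?thesis by (simp add: A)
    qed
    also have "det \<dots> = det (Q ** transpose Q) * det (diagonal_matrix (\<chi> i. x - d $ i))"
      by (simp only: det_mul) simp
    also have "\<dots> = (\<Prod>i\<in>UNIV. x - d $ i)"
      by (subst det_diagonal) (auto simp: QQ diagonal_matrix_def)
    finally show ?thesis by (simp add: poly_prod)
  qed
  then have "char_polynomial A = (\<Prod>i\<in>UNIV. [:- d $ i, 1:])"
    by (simp add: poly_eq_poly_eq_iff[symmetric] fun_eq_iff)
  then have "eigenvalues A = (\<Sum>i\<in>UNIV. {# d $ i #})"
    by (simp add: eigenvalues_def proots_prod)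
  also have "\<dots> = image_mset (\<lambda>i. d $ i) (mset_set UNIV)"
  proof -
    have "(\<Sum>i\<in>S. {# d $ i #}) = image_mset (\<lambda>i. d $ i) (mset_set S)" if "finite S" for S
      using that by (induction S rule: finite_induct) auto
    then show ?thesis by simp
  qed
  finally show ?thesis .
qed

lemma trace_orthogonal_conj:
  fixes Q :: "real ^ 'n ^ 'n"
  assumes "orthogonal_matrix Q"
  shows "trace (Q ** X ** transpose Q) = trace X"
  by (metis assms matrix_mul_assoc matrix_mul_lid orthogonal_matrix_def trace_mul_sym)

text \<open>In an eigenbasis \<open>matrix_powr A p\<close> is diagonal with entries
  \<open>e $ i\<close>, nonnegative as values of \<open>powr\<close>; the five facts are read off in
  these coordinates.\<close>

lemma symmetric_matrix_powr_properties:
  fixes A :: "real ^ 'n ^ 'n"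
  assumes sym: "transpose A = A"
  shows "schatten_norm p A = trace (matrix_powr A p) powr (1 / p)"
    and "transpose (matrix_powr A p) = matrix_powr A p"
    and "0 \<le> trace (matrix_powr A p)"
    and "trace (matrix_powr A p ** matrix_powr A p) \<le> (trace (matrix_powr A p))\<^sup>2"
    and "0 \<le> x \<bullet> (matrix_powr A p *v x)"
proof -
  obtain Q d where Q: "orthogonal_matrix Q" and A: "A = Q ** diagonal_matrix d ** transpose Q"
    using symmetric_spectral_decomposition[OF sym] by metis
  define e where "e = (\<chi> i. d $ i powr p)"
  have B: "matrix_powr A p = Q ** diagonal_matrix e ** transpose Q"
    unfolding e_def by (rule matrix_powr_eq[OF Q A])
  have e: "0 \<le> e $ i" for i by (simp add: e_def)
  have trD: "trace (diagonal_matrix f) = (\<Sum>i\<in>UNIV. f $ i)" for f :: "real ^ 'n"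
    by (simp add: trace_def diagonal_matrix_def)
  have tr: "trace (matrix_powr A p) = (\<Sum>i\<in>UNIV. e $ i)"
    by (simp add: B trace_orthogonal_conj[OF Q] trD)
  show "schatten_norm p A = trace (matrix_powr A p) powr (1 / p)"
    unfolding schatten_norm_def eigenvalues_spectral[OF Q A] tr e_def
    by (simp add: sum_unfold_sum_mset image_mset.compositionality comp_def)
  have trans: "transpose (diagonal_matrix e) = diagonal_matrix e"
    by (simp add: vec_eq_iff transpose_def diagonal_matrix_def)
  show "transpose (matrix_powr A p) = matrix_powr A p"
    by (simp add: B matrix_transpose_mul trans matrix_mul_assoc)
  show "0 \<le> trace (matrix_powr A p)" using e by (simp add: tr sum_nonneg)
  have "matrix_powr A p ** matrix_powr A p = Q ** diagonal_matrix e ** (transpose Q ** Q) ** diagonal_matrix e ** transpose Q"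
    unfolding B by (simp only: matrix_mul_assoc)
  also have "\<dots> = Q ** (diagonal_matrix e ** diagonal_matrix e) ** transpose Q"
    using Q by (simp add: orthogonal_matrix_def matrix_mul_assoc)
  finally have "trace (matrix_powr A p ** matrix_powr A p) = trace (diagonal_matrix e ** diagonal_matrix e)"
    by (simp add: trace_orthogonal_conj[OF Q])
  also have "\<dots> = (\<Sum>i\<in>UNIV. (e $ i)\<^sup>2)"
    by (simp add: trace_def matrix_mult_diagonal_nth) (simp add: diagonal_matrix_def power2_eq_square)
  also have "\<dots> \<le> (\<Sum>i\<in>UNIV. e $ i)\<^sup>2"
  proof -
    \<comment> \<open>The square of the sum contains every \<open>(e $ i)\<^sup>2\<close>, and its
      remaining products are nonnegative.\<close>
    have "e $ i * e $ i \<le> (\<Sum>j\<in>UNIV. e $ i * e $ j)" for i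
      using e by (intro member_le_sum[where f = "\<lambda>j. e $ i * e $ j"]) auto
    then show ?thesis by (simp add: power2_eq_square sum_product sum_mono)
  qed
  finally show "trace (matrix_powr A p ** matrix_powr A p) \<le> (trace (matrix_powr A p))\<^sup>2"
    by (simp add: tr)
  have "x \<bullet> (matrix_powr A p *v x) = (transpose Q *v x) \<bullet> (diagonal_matrix e *v (transpose Q *v x))"
    by (simp add: B matrix_vector_mul_assoc[symmetric] dot_lmul_matrix[symmetric] transpose_matrix_vector)
  also have "\<dots> = (\<Sum>i\<in>UNIV. e $ i * ((transpose Q *v x) $ i)\<^sup>2)"
  proof -
    have "(diagonal_matrix e *v y) $ i = e $ i * y $ i" for y i
      by (simp add: matrix_vector_mult_def diagonal_matrix_def if_distrib[of "\<lambda>x. x * _"] cong: if_cong)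
    then show ?thesis by (simp add: inner_vec_def power2_eq_square mult_ac)
  qed
  also have "\<dots> \<ge> 0" using e by (simp add: sum_nonneg)
  finally show "0 \<le> x \<bullet> (matrix_powr A p *v x)" .
qed

section \<open>Mixed moments of a standard Gaussian vector\<close>

context prob_space
begin

text \<open>Independence factorises the expectation of a monomial, which is encoded by its exponents
  \<open>c\<close>. Stating it with \<open>has_bochner_integral\<close> carries integrability along
  with the value, so that polynomials can be integrated term by term.\<close>

lemma standard_gaussian_vector_moment:
  fixes w :: "'a \<Rightarrow> real ^ 'n"
  assumes "standard_gaussian_vector w"
  shows "has_bochner_integral M (\<lambda>\<omega>. \<Prod>m\<in>UNIV. w \<omega> $ m ^ c m)
    (\<Prod>m\<in>UNIV. \<integral>x. std_normal_density x * x ^ c m \<partial>lborel)"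
proof -
  have indep: "indep_vars (\<lambda>_. borel) (\<lambda>i \<omega>. w \<omega> $ i ^ c i) UNIV"
    using assms unfolding standard_gaussian_vector_def
    by (intro indep_vars_compose2[where Y = "\<lambda>i x. x ^ c i"]) auto
  have dist: "distributed M lborel (\<lambda>\<omega>. w \<omega> $ i) std_normal_density" for i
    using assms by (simp add: standard_gaussian_vector_def)
  have int: "integrable M (\<lambda>\<omega>. w \<omega> $ i ^ c i)" for i
    using distributed_integrable[OF dist, of "\<lambda>x. x ^ c i" i] integrable_std_normal_moment by simp
  have val: "(\<integral>\<omega>. w \<omega> $ i ^ c i \<partial>M) = (\<integral>x. std_normal_density x * x ^ c i \<partial>lborel)" for i
    using distributed_integral[OF dist, of "\<lambda>x. x ^ c i" i] by simp
  show ?thesis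
    unfolding has_bochner_integral_iff val[symmetric]
    using indep_vars_integrable[OF _ indep int] indep_vars_lebesgue_integral[OF _ indep int] by simp
qed

end

lemma quadratic_form_sum:
  "(x :: real ^ 'n) \<bullet> (B *v x) = (\<Sum>i\<in>UNIV. \<Sum>j\<in>UNIV. B $ i $ j * (x $ i * x $ j))"
  by (simp add: inner_vec_def matrix_vector_mult_def sum_distrib_left mult_ac)

lemma std_normal_low_moments:
  "(\<integral>x. std_normal_density x * x ^ 0 \<partial>lborel) = 1"
  "(\<integral>x. std_normal_density x * x ^ 1 \<partial>lborel) = 0"
  "(\<integral>x. std_normal_density x * x ^ 2 \<partial>lborel) = 1"
  "(\<integral>x. std_normal_density x * x ^ 3 \<partial>lborel) = 0"
  "(\<integral>x. std_normal_density x * x ^ 4 \<partial>lborel) = 3"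
  using integral_std_normal_moment_even[of 0] integral_std_normal_moment_odd[of 0]
    integral_std_normal_moment_even[of 1] integral_std_normal_moment_odd[of 1]
    integral_std_normal_moment_even[of 2]
  by (simp_all add: fact_numeral)

text \<open>The combinatorial core of Isserlis' theorem: the argument of \<open>\<mu>\<close> is the
  multiplicity of \<open>m\<close> among the four indices, and odd multiplicities give a zero
  factor. Only patterns that split into equal pairs survive; if all four indices agree,
  \<open>\<mu> 4 = 3\<close> accounts for the three pairings.\<close>

lemma prod_fourth_moment:
  fixes \<mu> :: "nat \<Rightarrow> real" and i j k l :: "'n :: finite"
  assumes "\<mu> 0 = 1" "\<mu> 1 = 0" "\<mu> 2 = 1" "\<mu> 3 = 0" "\<mu> 4 = 3"
  shows "(\<Prod>m\<in>UNIV. \<mu> (of_bool (m = i) + of_bool (m = j) + of_bool (m = k) + of_bool (m = l))) =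
    of_bool (i = j) * of_bool (k = l) + of_bool (i = k) * of_bool (j = l) + of_bool (i = l) * of_bool (j = k)"
    (is "prod ?f UNIV = ?R")
proof -
  have \<mu>: "\<mu> 0 = 1" "\<mu> (Suc 0) = 0" "\<mu> (Suc (Suc 0)) = 1" "\<mu> (Suc (Suc (Suc 0))) = 0"
    "\<mu> (Suc (Suc (Suc (Suc 0)))) = 3"
    using assms by (simp_all add: numeral_eq_Suc)
  have zero: "prod ?f UNIV = 0" if "\<exists>m. ?f m = 0" using that by (intro prod_zero) auto
  consider (eq) "i = j" "k = l" "i = k" | (ij) "i = j" "k = l" "i \<noteq> k"
    | (ik) "i = k" "j = l" "i \<noteq> j" | (il) "i = l" "j = k" "i \<noteq> j"
    | (no) "\<not> (i = j \<and> k = l)" "\<not> (i = k \<and> j = l)" "\<not> (i = l \<and> j = k)" by blast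
  then show ?thesis
  proof cases
    case eq
    then have "prod ?f UNIV = (\<Prod>m\<in>UNIV. if m = i then 3 else 1)"
      using \<mu> by (intro prod.cong) auto
    then show ?thesis using eq by simp
  next
    case ij
    then have "prod ?f UNIV = 1" using \<mu> by (intro prod.neutral) auto
    then show ?thesis using ij by simp
  next
    case ik
    then have "prod ?f UNIV = 1" using \<mu> by (intro prod.neutral) auto
    then show ?thesis using ik by simp
  next
    case il
    then have "prod ?f UNIV = 1" using \<mu> by (intro prod.neutral) auto
    then show ?thesis using il by simp
  next
    case no
    \<comment> \<open>With no pairing the multiplicities are 3+1, 2+1+1 or 1+1+1+1, so some index
      occurs exactly once and contributes \<open>\<mu> 1 = 0\<close>.\<close>
    have "?f i = 0 \<or> ?f j = 0 \<or> ?f k = 0 \<or> ?f l = 0"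
      using no \<mu> by (cases "i = j"; cases "k = l"; cases "i = k"; cases "i = l"; cases "j = k"; cases "j = l") auto
    then have "prod ?f UNIV = 0" by (intro zero) blast
    moreover have "?R = 0" using no by (cases "i = j"; cases "i = k"; cases "i = l") auto
    ultimately show ?thesis by (simp only:)
  qed
qed

context prob_space
begin

lemma standard_gaussian_vector_second_moment:
  fixes w :: "'a \<Rightarrow> real ^ 'n"
  assumes "standard_gaussian_vector w"
  shows "has_bochner_integral M (\<lambda>\<omega>. w \<omega> $ i * w \<omega> $ j) (of_bool (i = j))"
proof -
  let ?\<mu> = "\<lambda>k. \<integral>x. std_normal_density x * x ^ k \<partial>lborel"
  \<comment> \<open>The multiplicity of \<open>m\<close> among the indices, which writes the product
    of entries as a monomial over all coordinates.\<close>
  define c where "c m = of_bool (m = i) + (of_bool (m = j) :: nat)" for m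
  have "(\<Prod>m\<in>UNIV. w \<omega> $ m ^ c m) = w \<omega> $ i * w \<omega> $ j" for \<omega>
  proof -
    have "(\<Prod>m\<in>UNIV. w \<omega> $ m ^ of_bool (m = k)) = w \<omega> $ k" for k
      by (simp add: of_bool_def if_distrib[of "\<lambda>n. _ ^ n"] cong: if_cong)
    then show ?thesis by (simp add: c_def power_add prod.distrib)
  qed
  moreover have "(\<Prod>m\<in>UNIV. ?\<mu> (c m)) = of_bool (i = j)"
  proof (cases "i = j")
    case True
    then show ?thesis using std_normal_low_moments
      by (intro trans[OF prod.neutral]) (auto simp: c_def numeral_2_eq_2)
  next
    case False
    then have "?\<mu> (c i) = 0" using std_normal_low_moments by (simp add: c_def)
    then have "(\<Prod>m\<in>UNIV. ?\<mu> (c m)) = 0" by (intro prod_zero) auto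
    then show ?thesis using False by simp
  qed
  ultimately show ?thesis
    using standard_gaussian_vector_moment[OF assms, of c] by simp
qed

lemma standard_gaussian_vector_fourth_moment:
  fixes w :: "'a \<Rightarrow> real ^ 'n"
  assumes "standard_gaussian_vector w"
  shows "has_bochner_integral M (\<lambda>\<omega>. w \<omega> $ i * w \<omega> $ j * w \<omega> $ k * w \<omega> $ l)
    (of_bool (i = j) * of_bool (k = l) + of_bool (i = k) * of_bool (j = l)
      + of_bool (i = l) * of_bool (j = k))"
proof -
  define c where "c m = of_bool (m = i) + of_bool (m = j) + of_bool (m = k) + (of_bool (m = l) :: nat)" for m
  have "(\<Prod>m\<in>UNIV. w \<omega> $ m ^ c m) = w \<omega> $ i * w \<omega> $ j * w \<omega> $ k * w \<omega> $ l" for \<omega>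
  proof -
    have "(\<Prod>m\<in>UNIV. w \<omega> $ m ^ of_bool (m = k)) = w \<omega> $ k" for k
      by (simp add: of_bool_def if_distrib[of "\<lambda>n. _ ^ n"] cong: if_cong)
    then show ?thesis by (simp add: c_def power_add prod.distrib)
  qed
  then show ?thesis
    using standard_gaussian_vector_moment[OF assms, of c]
    unfolding c_def prod_fourth_moment[of "\<lambda>k. \<integral>x. std_normal_density x * x ^ k \<partial>lborel", OF std_normal_low_moments]
    by simp
qed

section \<open>Mean and second moment of a Gaussian quadratic form\<close>

lemma standard_gaussian_quadratic_form_mean:
  fixes w :: "'a \<Rightarrow> real ^ 'n"
  assumes "standard_gaussian_vector w"
  shows "has_bochner_integral M (\<lambda>\<omega>. w \<omega> \<bullet> (B *v w \<omega>)) (trace B)"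
proof -
  have "has_bochner_integral M (\<lambda>\<omega>. w \<omega> \<bullet> (B *v w \<omega>))
     (\<Sum>i\<in>UNIV. \<Sum>j\<in>UNIV. B $ i $ j * of_bool (i = j))"
    unfolding quadratic_form_sum
    by (intro has_bochner_integral_sum has_bochner_integral_mult_right
        standard_gaussian_vector_second_moment assms)
  then show ?thesis by (simp add: trace_def of_bool_def if_distrib[of "(*) _"] cong: if_cong)
qed

text \<open>The pairing of \<open>i\<close> with \<open>j\<close> contributes
  \<open>(trace B)\<^sup>2\<close>. The other two pairings give the sums of
  \<open>B $ i $ j * B $ i $ j\<close> and \<open>B $ i $ j * B $ j $ i\<close>, and by symmetry
  each is \<open>trace (B ** B)\<close>.\<close>

lemma standard_gaussian_quadratic_form_square:
  fixes w :: "'a \<Rightarrow> real ^ 'n"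
  assumes "standard_gaussian_vector w" and sym: "transpose B = B"
  shows "has_bochner_integral M (\<lambda>\<omega>. (w \<omega> \<bullet> (B *v w \<omega>))\<^sup>2) ((trace B)\<^sup>2 + 2 * trace (B ** B))"
proof -
  \<comment> \<open>The order \<open>i\<close>, \<open>k\<close>, \<open>j\<close>, \<open>l\<close>
    of the sums is the one that \<open>sum_product\<close> yields for a product of two double
    sums.\<close>
  have sq: "(x \<bullet> (B *v x))\<^sup>2 = (\<Sum>i\<in>UNIV. \<Sum>k\<in>UNIV. \<Sum>j\<in>UNIV. \<Sum>l\<in>UNIV.
      B $ i $ j * B $ k $ l * (x $ i * x $ j * x $ k * x $ l))" for x :: "real ^ 'n"
    unfolding quadratic_form_sum power2_eq_square sum_product by (simp add: mult_ac)
  have "has_bochner_integral M (\<lambda>\<omega>. (w \<omega> \<bullet> (B *v w \<omega>))\<^sup>2)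
     (\<Sum>i\<in>UNIV. \<Sum>k\<in>UNIV. \<Sum>j\<in>UNIV. \<Sum>l\<in>UNIV. B $ i $ j * B $ k $ l *
        (of_bool (i = j) * of_bool (k = l) + of_bool (i = k) * of_bool (j = l)
      + of_bool (i = l) * of_bool (j = k)))"
    unfolding sq
    by (intro has_bochner_integral_sum has_bochner_integral_mult_right
        standard_gaussian_vector_fourth_moment assms)
  also have "(\<Sum>i\<in>UNIV. \<Sum>k\<in>UNIV. \<Sum>j\<in>UNIV. \<Sum>l\<in>UNIV. B $ i $ j * B $ k $ l *
        (of_bool (i = j) * of_bool (k = l) + of_bool (i = k) * of_bool (j = l)
      + of_bool (i = l) * of_bool (j = k))) =
      (\<Sum>i\<in>UNIV. \<Sum>k\<in>UNIV. B $ i $ i * B $ k $ k) + (\<Sum>i\<in>UNIV. \<Sum>j\<in>UNIV. B $ i $ j * B $ i $ j)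
      + (\<Sum>i\<in>UNIV. \<Sum>j\<in>UNIV. B $ i $ j * B $ j $ i)"
  proof -
    \<comment> \<open>Nested conditionals let the sums over paired indices collapse;
      \<open>pull\<close> moves a condition free of the summation index outward.\<close>
    have ind: "x * (of_bool P * of_bool Q) = (if Q then if P then x else 0 else 0)" for x :: real and P Q
      by simp
    have pull: "(\<Sum>j\<in>S. if P then f j else 0) = (if P then \<Sum>j\<in>S. f j else 0)"
      for P S and f :: "'n \<Rightarrow> real" by simp
    show ?thesis unfolding distrib_left sum.distrib ind by (simp add: pull)
  qed
  also have "\<dots> = (trace B)\<^sup>2 + 2 * trace (B ** B)"
  proof -
    have "transpose B $ j $ i = B $ i $ j" for i j by (simp add: transpose_def)
    then have "B $ i $ j = B $ j $ i" for i j using sym by simp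
    then show ?thesis
      by (simp add: trace_def power2_eq_square sum_product matrix_matrix_mult_def)
  qed
  finally show ?thesis .
qed

section \<open>Second moment of an independent sum and mean absolute deviation\<close>

text \<open>Each new summand is centred and independent of the partial sum \<open>?Y\<close>, so the
  cross term has expectation zero.\<close>

lemma indep_vars_sum_centered_square:
  fixes X :: "'i \<Rightarrow> 'a \<Rightarrow> real"
  assumes "finite I" "indep_vars (\<lambda>_. borel) X I"
    and "\<And>i. i \<in> I \<Longrightarrow> integrable M (\<lambda>\<omega>. (X i \<omega>)\<^sup>2)" "\<And>i. i \<in> I \<Longrightarrow> expectation (X i) = 0"
  shows "has_bochner_integral M (\<lambda>\<omega>. (\<Sum>i\<in>I. X i \<omega>)\<^sup>2) (\<Sum>i\<in>I. expectation (\<lambda>\<omega>. (X i \<omega>)\<^sup>2))"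
  using assms
proof (induction I rule: finite_induct)
  case (insert i I)
  let ?Y = "\<lambda>\<omega>. \<Sum>i\<in>I. X i \<omega>"
  have rv: "random_variable borel (X j)" if "j \<in> insert i I" for j
    using that insert.prems(1) by (auto simp: indep_vars_def)
  have int: "integrable M (X j)" if "j \<in> insert i I" for j
    by (rule square_integrable_imp_integrable[OF rv[OF that] insert.prems(2)[OF that]])
  have indep: "indep_var borel (X i) borel ?Y"
    using insert by (intro indep_vars_sum) auto
  have "indep_vars (\<lambda>_. borel) X I"
    using insert.prems(1) by (rule indep_vars_subset) auto
  then have Y2: "has_bochner_integral M (\<lambda>\<omega>. (?Y \<omega>)\<^sup>2) (\<Sum>i\<in>I. expectation (\<lambda>\<omega>. (X i \<omega>)\<^sup>2))"
    using insert by auto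
  have Y: "integrable M ?Y" using int by auto
  have cross: "has_bochner_integral M (\<lambda>\<omega>. 2 * (X i \<omega> * ?Y \<omega>)) 0"
    using indep_var_integrable[OF indep int Y] indep_var_lebesgue_integral[OF indep int Y] insert.prems(3)
    by (simp add: has_bochner_integral_iff)
  have X2: "has_bochner_integral M (\<lambda>\<omega>. (X i \<omega>)\<^sup>2) (expectation (\<lambda>\<omega>. (X i \<omega>)\<^sup>2))"
    using insert.prems(2) by (simp add: has_bochner_integral_iff)
  have "(\<lambda>\<omega>. (\<Sum>j\<in>insert i I. X j \<omega>)\<^sup>2) = (\<lambda>\<omega>. (X i \<omega>)\<^sup>2 + 2 * (X i \<omega> * ?Y \<omega>) + (?Y \<omega>)\<^sup>2)"
    using insert.hyps by (simp add: power2_sum fun_eq_iff)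
  then show ?case
    using has_bochner_integral_add[OF has_bochner_integral_add[OF X2 cross] Y2] insert.hyps by simp
qed (simp add: has_bochner_integral_zero)

text \<open>The variance of \<open>\<bar>Z\<bar>\<close> is nonnegative.\<close>

lemma expectation_abs_le_sqrt:
  fixes Z :: "'a \<Rightarrow> real"
  assumes "random_variable borel Z" "integrable M (\<lambda>\<omega>. (Z \<omega>)\<^sup>2)"
  shows "expectation (\<lambda>\<omega>. \<bar>Z \<omega>\<bar>) \<le> sqrt (expectation (\<lambda>\<omega>. (Z \<omega>)\<^sup>2))"
proof -
  have "integrable M Z" using assms by (rule square_integrable_imp_integrable)
  then have "variance (\<lambda>\<omega>. \<bar>Z \<omega>\<bar>) = expectation (\<lambda>\<omega>. (Z \<omega>)\<^sup>2) - (expectation (\<lambda>\<omega>. \<bar>Z \<omega>\<bar>))\<^sup>2"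
    using assms by (subst variance_eq) auto
  then have "(expectation (\<lambda>\<omega>. \<bar>Z \<omega>\<bar>))\<^sup>2 \<le> expectation (\<lambda>\<omega>. (Z \<omega>)\<^sup>2)"
    using variance_positive[of "\<lambda>\<omega>. \<bar>Z \<omega>\<bar>"] by simp
  then show ?thesis by (rule real_le_rsqrt)
qed

end

section \<open>Stability of the root\<close>

text \<open>As \<open>0 < 1 / p \<le> 1\<close>, for positive \<open>t\<close> the root lies between
  \<open>t\<close> and \<open>1\<close>. At \<open>t = 0\<close> both sides equal \<open>1\<close>,
  because \<open>0 powr (1 / p) = 0\<close>.\<close>

lemma abs_powr_inverse_minus_one_le:
  fixes t p :: real
  assumes "0 \<le> t" "1 \<le> p"
  shows "\<bar>t powr (1 / p) - 1\<bar> \<le> \<bar>t - 1\<bar>"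
proof -
  consider "t = 0" | "0 < t" "t \<le> 1" | "1 < t" using assms by linarith
  then show ?thesis
  proof cases
    case 2
    then have "t powr 1 \<le> t powr (1 / p)" "t powr (1 / p) \<le> 1"
      using assms by (intro powr_mono' powr_le1; simp)+
    then show ?thesis using 2 by simp
  next
    case 3
    then have "t powr (1 / p) \<le> t powr 1" "1 \<le> t powr (1 / p)"
      using assms by (intro powr_mono ge_one_powr_ge_zero; simp)+
    then show ?thesis using 3 by simp
  qed simp
qed

text \<open>Homogeneity of the root reduces this to the previous bound at \<open>t = y / s\<close>:
  the relative error does not grow.\<close>

lemma abs_powr_inverse_diff_le:
  fixes s y p :: real
  assumes "0 \<le> y" "0 < s" "1 \<le> p"
  shows "\<bar>y powr (1 / p) - s powr (1 / p)\<bar> \<le> s powr (1 / p) / s * \<bar>y - s\<bar>"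
proof -
  have "y powr (1 / p) = s powr (1 / p) * (y / s) powr (1 / p)"
    using assms by (simp add: powr_divide)
  then have "\<bar>y powr (1 / p) - s powr (1 / p)\<bar> = s powr (1 / p) * \<bar>(y / s) powr (1 / p) - 1\<bar>"
    by (metis abs_mult abs_of_nonneg mult.right_neutral powr_ge_zero right_diff_distrib)
  also have "\<dots> \<le> s powr (1 / p) * \<bar>y / s - 1\<bar>"
    using assms by (intro mult_left_mono abs_powr_inverse_minus_one_le) auto
  also have "\<bar>y / s - 1\<bar> = \<bar>y - s\<bar> / s"
    using assms by (simp add: diff_divide_distrib[symmetric] abs_divide divide_simps)
  finally show ?thesis by simp
qed

section \<open>Bias of the estimator\<close>

theorem proposition5:
  fixes A :: "real ^ 'n ^ 'n" and p :: real and M :: nat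
    and P :: "'a measure" and w :: "nat \<Rightarrow> 'a \<Rightarrow> real ^ 'n"
  assumes "prob_space P"
    and "positive_semidefinite A"
    and "p \<ge> 1"
    and "M \<ge> 1"
    and "prob_space.indep_vars P (\<lambda>_. borel) w {1..M}"
    and "\<And>j. j \<in> {1..M} \<Longrightarrow> prob_space.standard_gaussian_vector P (w j)"
  shows "integrable P (schatten_estimator p A w M) \<and>
    \<bar>(\<integral>\<omega>. schatten_estimator p A w M \<omega> \<partial>P) - schatten_norm p A\<bar>
      \<le> schatten_norm p A * sqrt (2 / real M)"
  
proof -
  interpret prob_space P by (rule assms(1))
  define B where "B = matrix_powr A p"
  define s where "s = trace B"
  define N where "N = schatten_norm p A"
  define Y where "Y = (\<lambda>\<omega>. (1 / real M) * (\<Sum>j = 1..M. w j \<omega> \<bullet> (B *v w j \<omega>)))"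
  \<comment> \<open>The forms are centred at their common mean \<open>s\<close>, as the additivity
    of second moments requires.\<close>
  define X where "X = (\<lambda>j \<omega>. w j \<omega> \<bullet> (B *v w j \<omega>) - s)"
  have "transpose A = A" using assms(2) by (simp add: positive_semidefinite_def)
  note spectral = symmetric_matrix_powr_properties[OF this, where p = p, folded B_def, folded s_def N_def]
  have M: "real M > 0" using assms(4) by simp
  have est: "schatten_estimator p A w M = (\<lambda>\<omega>. Y \<omega> powr (1 / p))"
    by (simp add: fun_eq_iff schatten_estimator_def Y_def B_def)
  have Y0: "0 \<le> Y \<omega>" for \<omega> using spectral(5) by (simp add: Y_def sum_nonneg)
  have mean: "has_bochner_integral P (\<lambda>\<omega>. w j \<omega> \<bullet> (B *v w j \<omega>)) s"
    and square: "has_bochner_integral P (\<lambda>\<omega>. (w j \<omega> \<bullet> (B *v w j \<omega>))\<^sup>2) (s\<^sup>2 + 2 * trace (B ** B))"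
    if "j \<in> {1..M}" for j
    using standard_gaussian_quadratic_form_mean[OF assms(6)[OF that]]
      standard_gaussian_quadratic_form_square[OF assms(6)[OF that] spectral(2)] by (simp_all add: s_def)
  have Ymean: "has_bochner_integral P Y s"
  proof -
    have "has_bochner_integral P Y ((1 / real M) * (\<Sum>j = 1..M. s))"
      unfolding Y_def by (intro has_bochner_integral_mult_right has_bochner_integral_sum mean) auto
    then show ?thesis using M by simp
  qed
  then have Yint: "integrable P Y" and EY: "expectation Y = s"
    by (simp_all add: has_bochner_integral_iff)
  have [measurable]: "Y \<in> borel_measurable P" using Yint by simp
  \<comment> \<open>Each \<open>X j\<close> is one fixed continuous function of \<open>w j\<close>,
    so it inherits independence from the sample vectors.\<close>
  have "(\<lambda>x. x \<bullet> (B *v x) - s) \<in> borel_measurable borel"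
    by (intro borel_measurable_continuous_onI continuous_intros matrix_vector_mult_linear_continuous_on)
  then have indep: "indep_vars (\<lambda>_. borel) X {1..M}"
    unfolding X_def by (intro indep_vars_compose2[OF assms(5)])
  have X2: "has_bochner_integral P (\<lambda>\<omega>. (X j \<omega>)\<^sup>2) (2 * trace (B ** B))"
    and X1: "expectation (X j) = 0" if j: "j \<in> {1..M}" for j
  proof -
    have "(\<lambda>\<omega>. (X j \<omega>)\<^sup>2) = (\<lambda>\<omega>. (w j \<omega> \<bullet> (B *v w j \<omega>))\<^sup>2 - 2 * s * (w j \<omega> \<bullet> (B *v w j \<omega>)) + s\<^sup>2)"
      by (simp add: X_def power2_diff fun_eq_iff)
    moreover have "has_bochner_integral P (\<lambda>_. s\<^sup>2) (s\<^sup>2)"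
      by (simp add: has_bochner_integral_iff prob_space)
    ultimately show "has_bochner_integral P (\<lambda>\<omega>. (X j \<omega>)\<^sup>2) (2 * trace (B ** B))"
      using has_bochner_integral_add[OF has_bochner_integral_diff[OF square[OF j]
          has_bochner_integral_mult_right[OF mean[OF j], of "2 * s"]]]
      by (fastforce simp: power2_eq_square)
    show "expectation (X j) = 0"
      using mean[OF j] by (simp add: X_def has_bochner_integral_iff prob_space)
  qed
  have YX: "Y \<omega> - s = (1 / real M) * (\<Sum>j = 1..M. X j \<omega>)" for \<omega>
    using M by (simp add: Y_def X_def sum_subtractf field_simps)
  have sumX: "has_bochner_integral P (\<lambda>\<omega>. (\<Sum>j = 1..M. X j \<omega>)\<^sup>2) (real M * (2 * trace (B ** B)))"
  proof -
    have "has_bochner_integral P (\<lambda>\<omega>. (\<Sum>j = 1..M. X j \<omega>)\<^sup>2)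
        (\<Sum>j = 1..M. expectation (\<lambda>\<omega>. (X j \<omega>)\<^sup>2))"
      using X1 X2 by (intro indep_vars_sum_centered_square indep) (auto simp: has_bochner_integral_iff)
    also have "(\<Sum>j = 1..M. expectation (\<lambda>\<omega>. (X j \<omega>)\<^sup>2)) = (\<Sum>j = 1..M. 2 * trace (B ** B))"
      using X2 by (intro sum.cong) (auto simp: has_bochner_integral_iff)
    finally show ?thesis by simp
  qed
  \<comment> \<open>The factor \<open>(1 / real M)\<^sup>2\<close> meets \<open>M\<close> equal
    second moments, leaving a single \<open>1 / real M\<close>.\<close>
  have Yvar: "has_bochner_integral P (\<lambda>\<omega>. (Y \<omega> - s)\<^sup>2) (2 * trace (B ** B) / real M)"
    using has_bochner_integral_mult_right[OF sumX, of "(1 / real M)\<^sup>2"] M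
    unfolding YX power_mult_distrib by (simp add: power2_eq_square)
  have dev: "expectation (\<lambda>\<omega>. \<bar>Y \<omega> - s\<bar>) \<le> s * sqrt (2 / real M)"
  proof -
    have "expectation (\<lambda>\<omega>. \<bar>Y \<omega> - s\<bar>) \<le> sqrt (expectation (\<lambda>\<omega>. (Y \<omega> - s)\<^sup>2))"
      using Yvar by (intro expectation_abs_le_sqrt) (auto simp: has_bochner_integral_iff)
    also have "\<dots> \<le> sqrt (s\<^sup>2 * (2 / real M))"
      using Yvar spectral(4) M by (simp add: has_bochner_integral_iff field_simps)
    also have "\<dots> = s * sqrt (2 / real M)"
      using spectral(3) by (simp only: real_sqrt_mult real_sqrt_abs abs_of_nonneg)
    finally show ?thesis .
  qed
  show ?thesis
  \<comment> \<open>The relative bound divides by \<open>s\<close>. If \<open>s = 0\<close>, the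
    nonnegative \<open>Y\<close> has mean zero and vanishes almost everywhere; then the estimator
    and the norm are zero too, since \<open>0 powr (1 / p) = 0\<close>.\<close>
  proof (cases "s = 0")
    case True
    then have "AE \<omega> in P. Y \<omega> = 0"
      using integral_nonneg_eq_0_iff_AE[OF Yint] EY Y0 by auto
    then have ae: "AE \<omega> in P. Y \<omega> powr (1 / p) = 0" by eventually_elim simp
    then have "integrable P (\<lambda>\<omega>. Y \<omega> powr (1 / p))" "expectation (\<lambda>\<omega>. Y \<omega> powr (1 / p)) = 0"
      using integrable_cong_AE[of "\<lambda>\<omega>. Y \<omega> powr (1 / p)" P "\<lambda>_. 0"]
        integral_cong_AE[of "\<lambda>\<omega>. Y \<omega> powr (1 / p)" P "\<lambda>_. 0"] by simp_all
    then show ?thesis using True spectral(1) by (simp add: est flip: N_def)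
  next
    case False
    then have s: "s > 0" using spectral(3) by simp
    \<comment> \<open>Here \<open>N = s powr (1 / p)\<close>. This pointwise bound gives
      integrability of the estimator by domination and, after integration, the bias estimate, in
      which \<open>s\<close> cancels against \<open>dev\<close>.\<close>
    have bound: "\<bar>Y \<omega> powr (1 / p) - N\<bar> \<le> N / s * \<bar>Y \<omega> - s\<bar>" for \<omega>
      unfolding spectral(1) by (rule abs_powr_inverse_diff_le[OF Y0 s assms(3)])
    have int: "integrable P (\<lambda>\<omega>. N / s * \<bar>Y \<omega> - s\<bar>)" using Yint by simp
    then have diff: "integrable P (\<lambda>\<omega>. Y \<omega> powr (1 / p) - N)"
    proof (rule Bochner_Integration.integrable_bound)
      show "AE \<omega> in P. norm (Y \<omega> powr (1 / p) - N) \<le> norm (N / s * \<bar>Y \<omega> - s\<bar>)"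
        unfolding real_norm_def by (intro AE_I2 order_trans[OF bound abs_ge_self])
    qed measurable
    then have "integrable P (\<lambda>\<omega>. Y \<omega> powr (1 / p) - N + N)" by (intro Bochner_Integration.integrable_add) auto
    then have estint: "integrable P (\<lambda>\<omega>. Y \<omega> powr (1 / p))" by simp
    then have "\<bar>expectation (\<lambda>\<omega>. Y \<omega> powr (1 / p)) - N\<bar> = \<bar>expectation (\<lambda>\<omega>. Y \<omega> powr (1 / p) - N)\<bar>"
      by (simp add: prob_space)
    also have "\<dots> \<le> expectation (\<lambda>\<omega>. \<bar>Y \<omega> powr (1 / p) - N\<bar>)" by (rule integral_abs_bound)
    also have "\<dots> \<le> expectation (\<lambda>\<omega>. N / s * \<bar>Y \<omega> - s\<bar>)"
      using diff int bound by (intro integral_mono) auto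
    also have "\<dots> = N / s * expectation (\<lambda>\<omega>. \<bar>Y \<omega> - s\<bar>)" by simp
    also have "\<dots> \<le> N / s * (s * sqrt (2 / real M))"
      using s by (intro mult_left_mono dev) (simp add: spectral(1))
    also have "\<dots> = N * sqrt (2 / real M)" using s by simp
    finally show ?thesis using estint by (simp add: est flip: N_def)
  qed
qed

end
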